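(* Consider the $K$-armed bandit model described in the context, and suppose the noise is conditionally sub-Gaussian with parameter $\sigma_g>0$: $$\mathbb{E}[e^{\lambda\epsilon_t}\mid\mathcal{F}_{t-1}]\le e^{\sigma_g^2\lambda^2/2}\qquad\text{for all }\lambda\in\mathbb{R}\text{ and all }t\ge1.$$ Let $f(x)=\Big(\dfrac{\log 2}{x\,\log(e^2x)\,(\log\log(e^2x))^{2}}\Big)^{1/2}$ for $x\ge1$. Let $s_0$ be $\mathcal{F}_0$-measurable with $s_0>1$, and for each arm $k$ and round $t$ define $$s_{t,k}=s_0+\sum_{i=1}^t x_{i,k}^2,\qquad w_{t,k}=f\Big(\frac{s_{t,k}}{s_0}\Big)\frac{x_{t,k}}{\sqrt{s_0}},$$ where $x_{t,k}$ is the $k$-th coordinate of $\boldsymbol{x}_t$. Let $\widehat\theta_{\mathrm{ALEE},k}$ be the $k$-th coordinate of the ALEE estimator with weights $\boldsymbol{w}_t=(w_{t,1},\ldots,w_{t,K})^\top$. Then for every $n\ge 1$, every arm $k\in[K]$ and every $\delta\in(0,1)$, with probability at least $1-\delta$, $$|\widehat\theta_{\mathrm{ALEE},k}-\theta_k^*|\ \le\ \sigma_g\sqrt{\log(2/\delta^2)}\;\frac{\sqrt{2+\log(s_{n,k}/s_0)}\;\log\{2+\log(s_{n,k}/s_0)\}}{\sqrt{s_{n,k}}-\sqrt{s_0}}.$$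
   Context: $K$-armed bandit model: $\boldsymbol{\theta}^*=(\theta_1^*,\ldots,\theta_K^* )^\top\in\mathbb{R}^K$ is the deterministic vector of arm means and $y_t=\boldsymbol{x}_t^\top\boldsymbol{\theta}^*+\epsilon_t$ for $t\in[n]$, where each $\boldsymbol{x}_t$ is one of the standard basis vectors $\boldsymbol{e}_1,\ldots,\boldsymbol{e}_K$ of $\mathbb{R}^K$ ($\boldsymbol{x}_t=\boldsymbol{e}_k$ means arm $k$ is pulled at round $t$). There is an increasing sequence of $\sigma$-fields $\{\mathcal{F}_t\}_{t\ge 0}$ such that $\sigma(\boldsymbol{x}_1,y_1,\ldots,\boldsymbol{x}_{t-1},y_{t-1},\boldsymbol{x}_t)\subseteq\mathcal{F}_{t-1}$ for each $t$ (so $\boldsymbol{x}_t$ is $\mathcal{F}_{t-1}$-measurable and $y_t,\epsilon_t$ are $\mathcal{F}_t$-measurable). The ALEE (adaptive linear estimating equations) estimator with weights $\boldsymbol{w}_t$ is a solution $\widehat{\boldsymbol{\theta}}_{\mathrm{ALEE}}$ of $\sum_{t=1}^n\boldsymbol{w}_t(y_t-\boldsymbol{x}_t^\top\widehat{\boldsymbol{\theta}}_{\mathrm{ALEE}})=\mathbf{0}$; with the weights used here its $k$-th coordinate satisfies $\sum_{t=1}^n w_{t,k}(y_t-x_{t,k}\widehat\theta_{\mathrm{ALEE},k})=0$. When arm $k$ is never pulled ($s_{n,k}=s_0$) the right-hand side of the bound is interpreted as $+\infty$. *)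

theory Defs
  imports "HOL-Probability.Probability"
begin

text \<open>The sigma-field generated by \<open>x\<^sub>1, y\<^sub>1, \<dots>, x\<^sub>t\<^sub>-\<^sub>1, y\<^sub>t\<^sub>-\<^sub>1, x\<^sub>t\<close>. Rounds are numbered from 1;
  index 0 of the processes is unused.\<close>

definition history ::
  "'a measure \<Rightarrow> (nat \<Rightarrow> 'a \<Rightarrow> real ^ 'k) \<Rightarrow> (nat \<Rightarrow> 'a \<Rightarrow> real) \<Rightarrow> nat \<Rightarrow> 'a measure" where
  "history M x y t = sigma (space M)
     ((\<Union>i\<in>{1..t}. {x i -` A \<inter> space M | A. A \<in> sets borel}) \<union>
      (\<Union>i\<in>{1..<t}. {y i -` B \<inter> space M | B. B \<in> sets borel}))"

text \<open>The arms are the elements of the finite type \<open>'k\<close>, so \<open>K = CARD('k)\<close>, and \<open>axis k 1\<close> is the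
  standard basis vector \<open>e\<^sub>k\<close>. The horizon is \<open>n\<close>: nothing is required of rounds after \<open>n\<close>, which is
  why the measurability of \<open>y\<^sub>t\<close> with respect to \<open>F\<^sub>t\<close> is listed separately (at \<open>t = n\<close> it does not
  follow from the inclusions of the histories).\<close>

locale bandit_model = prob_space M + filtration "space M" F
  for M :: "'a measure" and F :: "nat \<Rightarrow> 'a measure" +
  fixes n :: nat
    and \<theta> :: "real ^ 'k"
    and x :: "nat \<Rightarrow> 'a \<Rightarrow> real ^ 'k"
    and y :: "nat \<Rightarrow> 'a \<Rightarrow> real"
    and \<epsilon> :: "nat \<Rightarrow> 'a \<Rightarrow> real"
  assumes F_subalgebra: "\<And>t. subalgebra M (F t)"
    and x_basis: "\<And>t \<omega>. t \<in> {1..n} \<Longrightarrow> \<omega> \<in> space M \<Longrightarrow> \<exists>k. x t \<omega> = axis k 1"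
    and y_eq: "\<And>t \<omega>. t \<in> {1..n} \<Longrightarrow> \<omega> \<in> space M \<Longrightarrow> y t \<omega> = x t \<omega> \<bullet> \<theta> + \<epsilon> t \<omega>"
    and history_F: "\<And>t. t \<in> {1..n} \<Longrightarrow> subalgebra (F (t - 1)) (history M x y t)"
    and y_measurable: "\<And>t. t \<in> {1..n} \<Longrightarrow> y t \<in> borel_measurable (F t)"

text \<open>The conditional expectation of the nonnegative variable \<open>exp (l * \<epsilon>\<^sub>t)\<close> is taken in
  \<open>[0, \<infinity>]\<close>, so that its finiteness is part of the condition (\<open>real_cond_exp\<close> would return \<open>0\<close>
  where it is infinite).\<close>

definition cond_subgaussian ::
  "'a measure \<Rightarrow> (nat \<Rightarrow> 'a measure) \<Rightarrow> nat \<Rightarrow> (nat \<Rightarrow> 'a \<Rightarrow> real) \<Rightarrow> real \<Rightarrow> bool" where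
  "cond_subgaussian M F n \<epsilon> \<sigma> \<longleftrightarrow>
     (\<forall>l::real. \<forall>t\<in>{1..n}. AE \<omega> in M.
        nn_cond_exp M (F (t - 1)) (\<lambda>\<omega>. ennreal (exp (l * \<epsilon> t \<omega>))) \<omega>
          \<le> ennreal (exp (\<sigma>\<^sup>2 * l\<^sup>2 / 2)))"

definition alee_f :: "real \<Rightarrow> real" where
  "alee_f u = sqrt (ln 2 / (u * ln (exp 2 * u) * (ln (ln (exp 2 * u)))\<^sup>2))"

definition alee_s ::
  "('a \<Rightarrow> real) \<Rightarrow> (nat \<Rightarrow> 'a \<Rightarrow> real ^ 'k) \<Rightarrow> nat \<Rightarrow> 'k \<Rightarrow> 'a \<Rightarrow> real" where
  "alee_s s0 x t k \<omega> = s0 \<omega> + (\<Sum>i=1..t. (x i \<omega> $ k)\<^sup>2)"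

definition alee_w ::
  "('a \<Rightarrow> real) \<Rightarrow> (nat \<Rightarrow> 'a \<Rightarrow> real ^ 'k) \<Rightarrow> nat \<Rightarrow> 'a \<Rightarrow> real ^ 'k" where
  "alee_w s0 x t \<omega> =
     (\<chi> k. alee_f (alee_s s0 x t k \<omega> / s0 \<omega>) * (x t \<omega> $ k / sqrt (s0 \<omega>)))"

text \<open>The estimating equation need not have a unique solution: coordinates of arms that were never
  pulled are unconstrained. Any solution is an ALEE estimator.\<close>

definition is_ALEE ::
  "'a measure \<Rightarrow> nat \<Rightarrow> (nat \<Rightarrow> 'a \<Rightarrow> real ^ 'k) \<Rightarrow> (nat \<Rightarrow> 'a \<Rightarrow> real ^ 'k) \<Rightarrow> (nat \<Rightarrow> 'a \<Rightarrow> real)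
     \<Rightarrow> ('a \<Rightarrow> real ^ 'k) \<Rightarrow> bool" where
  "is_ALEE M n w x y \<theta>h \<longleftrightarrow>
     (\<forall>\<omega>\<in>space M. (\<Sum>t=1..n. (y t \<omega> - x t \<omega> \<bullet> \<theta>h \<omega>) *\<^sub>R w t \<omega>) = 0)"

definition alee_bound :: "real \<Rightarrow> real \<Rightarrow> real \<Rightarrow> real \<Rightarrow> ereal" where
  "alee_bound \<sigma> \<delta> s0 s =
     (if s = s0 then \<infinity>
      else ereal (\<sigma> * sqrt (ln (2 / \<delta>\<^sup>2)) *
             (sqrt (2 + ln (s / s0)) * ln (2 + ln (s / s0)) / (sqrt s - sqrt s0))))"

end

theory Submission
  imports Defs
begin

text \<open>The ALEE error of arm \<open>k\<close> is \<open>(\<Sum>\<^sub>t w\<^sub>t \<epsilon>\<^sub>t) / (\<Sum>\<^sub>t w\<^sub>t)\<close>. The weights are predictable and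
  \<open>alee_f\<^sup>2\<close> has integral 1 over \<open>[1, \<infinity>)\<close>, so that \<open>\<Sum>\<^sub>t w\<^sub>t\<^sup>2 \<le> 1\<close>; the exponential
  supermartingale and Chernoff's bound then give \<open>|\<Sum>\<^sub>t w\<^sub>t \<epsilon>\<^sub>t| \<le> \<sigma> \<surd>(2 log (2/\<delta>\<^sup>2))\<close>
  outside an event of probability \<open>\<delta>\<^sup>2 \<le> \<delta>\<close>. The denominator is compared term by term with
  \<open>\<surd>s\<^sub>t - \<surd>s\<^sub>t\<^sub>-\<^sub>1\<close>. For the constant to come out right one needs
  \<open>(1 + 1/\<surd>2)\<^sup>2 log 2 \<ge> 2\<close>, which holds with little room (the left-hand side is about 2.02); this
  is where \<open>s\<^sub>0 > 1\<close> enters.\<close>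

section \<open>Exponential moments with a predictable multiplier\<close>

text \<open>The sub-Gaussian condition holds almost surely for each fixed \<open>l\<close>, whereas the multiplier \<open>L\<close> is
  random: for simple \<open>L\<close> one sums over its values, and Fatou's lemma gives the general case.\<close>

lemma nn_integral_subgaussian_predictable_le:
  fixes G :: "'a \<Rightarrow> ennreal" and e L :: "'a \<Rightarrow> real"
  assumes "finite_measure_subalgebra M N"
    and e [measurable]: "e \<in> borel_measurable M"
    and sub: "\<And>l::real. AE \<omega> in M. nn_cond_exp M N (\<lambda>\<omega>. ennreal (exp (l * e \<omega>))) \<omega>
                \<le> ennreal (exp (\<sigma>\<^sup>2 * l\<^sup>2 / 2))"
    and G: "G \<in> borel_measurable N" and L: "L \<in> borel_measurable N"
  shows "(\<integral>\<^sup>+ \<omega>. G \<omega> * ennreal (exp (L \<omega> * e \<omega> - \<sigma>\<^sup>2 * (L \<omega>)\<^sup>2 / 2)) \<partial>M) \<le> (\<integral>\<^sup>+ \<omega>. G \<omega> \<partial>M)"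
proof -
  interpret finite_measure_subalgebra M N by fact
  define E where "E l \<omega> = ennreal (exp (l * e \<omega> - \<sigma>\<^sup>2 * l\<^sup>2 / 2))" for l \<omega>
  have sp: "space N = space M" using subalg by (simp add: subalgebra_def)
  have [measurable]: "E l \<in> borel_measurable M" for l unfolding E_def by measurable
  have GM [measurable]: "G \<in> borel_measurable M" by (rule measurable_from_subalg[OF subalg G])
  \<comment> \<open>For a constant multiplier the conditional expectation replaces
    \<open>exp (l * e \<omega>)\<close> under the integral, and its bound cancels against the
    compensator in \<open>E\<close>. The factor \<open>H\<close> is kept general because it will be
    \<open>G\<close> times the indicator of a level set of a simple function.\<close>
  have const: "(\<integral>\<^sup>+ \<omega>. H \<omega> * E l \<omega> \<partial>M) \<le> (\<integral>\<^sup>+ \<omega>. H \<omega> \<partial>M)"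
    if H: "H \<in> borel_measurable N" for H :: "'a \<Rightarrow> ennreal" and l
  proof -
    let ?c = "ennreal (exp (- (\<sigma>\<^sup>2 * l\<^sup>2 / 2)))"
    have HM [measurable]: "H \<in> borel_measurable M" by (rule measurable_from_subalg[OF subalg H])
    have "E l \<omega> = ?c * ennreal (exp (l * e \<omega>))" for \<omega>
      unfolding E_def by (subst ennreal_mult'[symmetric]) (simp_all flip: exp_add)
    then have "(\<integral>\<^sup>+ \<omega>. H \<omega> * E l \<omega> \<partial>M) = (\<integral>\<^sup>+ \<omega>. ?c * (H \<omega> * ennreal (exp (l * e \<omega>))) \<partial>M)"
      by (simp only: mult.left_commute)
    also have "\<dots> = ?c * (\<integral>\<^sup>+ \<omega>. H \<omega> * ennreal (exp (l * e \<omega>)) \<partial>M)"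
      by (intro nn_integral_cmult) measurable
    also have "(\<integral>\<^sup>+ \<omega>. H \<omega> * ennreal (exp (l * e \<omega>)) \<partial>M)
        = (\<integral>\<^sup>+ \<omega>. H \<omega> * nn_cond_exp M N (\<lambda>\<omega>. ennreal (exp (l * e \<omega>))) \<omega> \<partial>M)"
      by (rule nn_cond_exp_intg[symmetric]) (use H in measurable)
    also have "\<dots> \<le> (\<integral>\<^sup>+ \<omega>. H \<omega> * ennreal (exp (\<sigma>\<^sup>2 * l\<^sup>2 / 2)) \<partial>M)"
      using sub[of l] by (intro nn_integral_mono_AE) (auto elim!: eventually_mono intro!: mult_left_mono)
    also have "\<dots> = (\<integral>\<^sup>+ \<omega>. H \<omega> \<partial>M) * ennreal (exp (\<sigma>\<^sup>2 * l\<^sup>2 / 2))"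
      by (intro nn_integral_multc) measurable
    also have "?c * \<dots> = (\<integral>\<^sup>+ \<omega>. H \<omega> \<partial>M) * (ennreal (exp (\<sigma>\<^sup>2 * l\<^sup>2 / 2)) * ?c)"
      by (simp add: mult_ac)
    also have "ennreal (exp (\<sigma>\<^sup>2 * l\<^sup>2 / 2)) * ?c = 1"
      by (subst ennreal_mult'[symmetric]) (simp_all flip: exp_add)
    finally show ?thesis by (simp add: mult_left_mono)
  qed
  have simple: "(\<integral>\<^sup>+ \<omega>. G \<omega> * E (l \<omega>) \<omega> \<partial>M) \<le> (\<integral>\<^sup>+ \<omega>. G \<omega> \<partial>M)"
    if l: "simple_function N l" for l
  proof -
    let ?R = "l ` space M"
    have fin: "finite ?R" using simple_functionD(1)[OF l] sp by simp
    have lN: "l \<in> borel_measurable N" by (rule borel_measurable_simple_function[OF l])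
    have [measurable]: "l \<in> borel_measurable M" by (rule measurable_from_subalg[OF subalg lN])
    have GN: "(\<lambda>\<omega>. G \<omega> * indicator {r} (l \<omega>)) \<in> borel_measurable N" for r
      using G lN by measurable
    have split: "g = (\<Sum>r\<in>?R. g * indicator {r} (l \<omega>))"
      if "\<omega> \<in> space M" for g :: ennreal and \<omega>
    proof -
      have "(\<Sum>r\<in>?R. g * indicator {r} (l \<omega>)) = (\<Sum>r\<in>?R. if r = l \<omega> then g else 0)"
        using that by (intro sum.cong) (auto simp: indicator_def)
      then show ?thesis using fin that by simp
    qed
    have "(\<integral>\<^sup>+ \<omega>. G \<omega> * E (l \<omega>) \<omega> \<partial>M)
        = (\<integral>\<^sup>+ \<omega>. (\<Sum>r\<in>?R. G \<omega> * indicator {r} (l \<omega>) * E r \<omega>) \<partial>M)"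
    proof (intro nn_integral_cong)
      fix \<omega> assume w: "\<omega> \<in> space M"
      show "G \<omega> * E (l \<omega>) \<omega> = (\<Sum>r\<in>?R. G \<omega> * indicator {r} (l \<omega>) * E r \<omega>)"
        by (subst split[OF w]) (auto intro!: sum.cong simp: indicator_def)
    qed
    also have "\<dots> = (\<Sum>r\<in>?R. \<integral>\<^sup>+ \<omega>. G \<omega> * indicator {r} (l \<omega>) * E r \<omega> \<partial>M)"
      by (intro nn_integral_sum) measurable
    also have "\<dots> \<le> (\<Sum>r\<in>?R. \<integral>\<^sup>+ \<omega>. G \<omega> * indicator {r} (l \<omega>) \<partial>M)"
      by (intro sum_mono const GN)
    also have "\<dots> = (\<integral>\<^sup>+ \<omega>. (\<Sum>r\<in>?R. G \<omega> * indicator {r} (l \<omega>)) \<partial>M)"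
      by (intro nn_integral_sum[symmetric]) measurable
    also have "\<dots> = (\<integral>\<^sup>+ \<omega>. G \<omega> \<partial>M)"
      by (intro nn_integral_cong split[symmetric])
    finally show ?thesis .
  qed
  obtain l where l: "\<And>i. simple_function N (l i)"
    and lim: "\<And>\<omega>. \<omega> \<in> space M \<Longrightarrow> (\<lambda>i. l i \<omega>) \<longlonglongrightarrow> L \<omega>"
    using borel_measurable_implies_sequence_metric[OF L, of 0] sp by metis
  have lM [measurable]: "l i \<in> borel_measurable M" for i
    by (rule measurable_from_subalg[OF subalg borel_measurable_simple_function[OF l]])
  have meas: "(\<lambda>\<omega>. G \<omega> * E (l i \<omega>) \<omega>) \<in> borel_measurable M" for i
    unfolding E_def by measurable
  have "(\<integral>\<^sup>+ \<omega>. G \<omega> * E (L \<omega>) \<omega> \<partial>M) = (\<integral>\<^sup>+ \<omega>. liminf (\<lambda>i. G \<omega> * E (l i \<omega>) \<omega>) \<partial>M)"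
  proof (intro nn_integral_cong)
    fix \<omega> assume w: "\<omega> \<in> space M"
    have "(\<lambda>i. E (l i \<omega>) \<omega>) \<longlonglongrightarrow> E (L \<omega>) \<omega>"
      unfolding E_def by (intro tendsto_intros lim[OF w]) auto
    then have "(\<lambda>i. G \<omega> * E (l i \<omega>) \<omega>) \<longlonglongrightarrow> G \<omega> * E (L \<omega>) \<omega>"
      \<comment> \<open>\<open>G\<close> may take the value \<infinity>; the product still converges
        because the limit of the other factor is positive and finite, so no form 0 * \<infinity>
        arises.\<close>
      by (intro tendsto_mult_ennreal tendsto_const) (auto simp: E_def)
    then show "G \<omega> * E (L \<omega>) \<omega> = liminf (\<lambda>i. G \<omega> * E (l i \<omega>) \<omega>)"
      by (intro lim_imp_Liminf[symmetric]) auto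
  qed
  also have "\<dots> \<le> liminf (\<lambda>i. \<integral>\<^sup>+ \<omega>. G \<omega> * E (l i \<omega>) \<omega> \<partial>M)"
    by (intro nn_integral_liminf meas)
  also have "\<dots> \<le> (\<integral>\<^sup>+ \<omega>. G \<omega> \<partial>M)"
    by (intro Liminf_le always_eventually allI simple l) auto
  finally show ?thesis unfolding E_def .
qed

section \<open>The weight function\<close>

text \<open>Apart from \<open>sqrt u\<close>, the denominator is exactly the numerator of the final
  bound. The square under the root can be released because the iterated logarithm is nonnegative for
  \<open>u \<ge> 1\<close>.\<close>

lemma alee_f_eq:
  assumes "u \<ge> 1"
  shows "alee_f u = sqrt (ln 2) / (sqrt u * (sqrt (2 + ln u) * ln (2 + ln u)))"
proof -
  have "ln (exp 2 * u) = 2 + ln u" using assms by (simp add: ln_mult)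
  moreover have "ln (2 + ln u) \<ge> 0" using assms by (simp add: ln_ge_zero)
  ultimately show ?thesis
    by (simp add: alee_f_def real_sqrt_divide real_sqrt_mult)
qed

lemma alee_f_nonneg: "u \<ge> 1 \<Longrightarrow> alee_f u \<ge> 0"
  by (simp add: alee_f_eq)

lemma alee_f_antimono:
  assumes "1 \<le> u" "u \<le> v"
  shows "alee_f v \<le> alee_f u"
proof -
  have "0 \<le> ln u" using assms by simp
  moreover from this have "0 < ln (2 + ln u)" "0 < 2 + ln u" by auto
  moreover have "ln u \<le> ln v" using assms by simp
  moreover have "ln (2 + ln u) \<le> ln (2 + ln v)" using calculation by (subst ln_le_cancel_iff) auto
  ultimately show ?thesis
    using assms unfolding alee_f_eq[OF assms(1)] alee_f_eq[OF order_trans[OF assms]]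
    by (intro divide_left_mono mult_mono mult_pos_pos mult_nonneg_nonneg) (auto simp: add_pos_nonneg)
qed

text \<open>This primitive falls from 1 at \<open>u = 1\<close> to 0 at infinity, which explains the
  normalisation by \<open>ln 2\<close> in \<open>alee_f\<close>.\<close>

lemma alee_f_primitive:
  assumes "u \<ge> 1"
  shows "((\<lambda>u. ln 2 / ln (2 + ln u)) has_real_derivative - (alee_f u)\<^sup>2) (at u)"
proof -
  have 1: "0 \<le> ln u" using assms by simp
  then have 2: "0 < ln (2 + ln u)" "0 < 2 + ln u" by auto
  have "alee_f u ^ 2 = ln 2 / (u * ((2 + ln u) * (ln (2 + ln u))\<^sup>2))"
    using assms 1 2 by (simp add: alee_f_eq power_divide power_mult_distrib)
  moreover have "((\<lambda>u. ln 2 / ln (2 + ln u)) has_real_derivative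
      - (ln 2 * ((1 / u) / (2 + ln u))) / (ln (2 + ln u))\<^sup>2) (at u)"
    using assms 1 2 by (auto intro!: derivative_eq_intros simp: power2_eq_square divide_simps)
  ultimately show ?thesis by (simp add: field_simps)
qed

section \<open>Deterministic bounds along one trajectory\<close>

text \<open>One arm and one outcome are fixed, so that \<open>b t\<close> is the pull indicator of
  round \<open>t\<close> and \<open>s0\<close> is a number. Everything here is pathwise and is later
  instantiated at each \<omega>.\<close>

locale arm_counts =
  fixes b :: "nat \<Rightarrow> real" and s0 :: real
  assumes b01: "\<And>t. b t = 0 \<or> b t = 1" and s0_pos: "s0 > 0"
begin

definition s :: "nat \<Rightarrow> real" where "s t = s0 + (\<Sum>i=1..t. (b i)\<^sup>2)"
definition w :: "nat \<Rightarrow> real" where "w t = alee_f (s t / s0) * (b t / sqrt s0)"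

lemma s_Suc: "s (Suc t) = s t + b (Suc t)"
  using b01[of "Suc t"] by (auto simp: s_def)

lemma s_ge: "s t \<ge> s0"
  by (simp add: s_def sum_nonneg)

lemma ratio_ge: "s t / s0 \<ge> 1"
  using s_ge[of t] s0_pos by simp

text \<open>Each squared weight is a right-endpoint Riemann rectangle for the integral of the decreasing
  function \<open>alee_f\<^sup>2\<close>, whose total mass on \<open>[1, \<infinity>)\<close> is 1.\<close>

lemma sum_w_squared_le: "(\<Sum>t=1..m. (w t)\<^sup>2) \<le> 1 - ln 2 / ln (2 + ln (s m / s0))"
proof (induction m)
  case 0
  then show ?case using s0_pos by (simp add: s_def)
next
  case (Suc m)
  let ?h = "\<lambda>u::real. ln 2 / ln (2 + ln u)"
  have "(w (Suc m))\<^sup>2 \<le> ?h (s m / s0) - ?h (s (Suc m) / s0)"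
  proof (cases "b (Suc m) = 0")
    case True
    then show ?thesis by (simp add: w_def s_Suc)
  next
    case False
    then have b: "b (Suc m) = 1" using b01 by blast
    have lt: "s m / s0 < s (Suc m) / s0" using s0_pos by (simp add: s_Suc b divide_strict_right_mono)
    \<comment> \<open>A pull moves the ratio by \<open>1 / s0\<close>, which is also the factor that
      \<open>(b t / sqrt s0)\<^sup>2\<close> contributes to the squared weight. Monotonicity then
      compares the value at the right endpoint with the one at \<open>z\<close>.\<close>
    obtain z where z: "s m / s0 < z" "z < s (Suc m) / s0"
      "?h (s (Suc m) / s0) - ?h (s m / s0) = (s (Suc m) / s0 - s m / s0) * (- (alee_f z)\<^sup>2)"
      using MVT2[OF lt, of ?h "\<lambda>u. - (alee_f u)\<^sup>2"] alee_f_primitive ratio_ge[of m] by force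
    have "(w (Suc m))\<^sup>2 = (alee_f (s (Suc m) / s0))\<^sup>2 / s0"
      using s0_pos by (simp add: w_def b power_mult_distrib power_divide)
    also have "\<dots> \<le> (alee_f z)\<^sup>2 / s0"
      using z order_trans[OF ratio_ge[of m] less_imp_le[OF z(1)]] ratio_ge[of "Suc m"] s0_pos
      by (intro divide_right_mono power_mono alee_f_antimono alee_f_nonneg) auto
    also have "\<dots> = ?h (s m / s0) - ?h (s (Suc m) / s0)"
      using z(3) s0_pos by (simp add: s_Suc b field_simps)
    finally show ?thesis .
  qed
  then show ?case using Suc.IH by simp
qed

end

section \<open>Lower bound for the sum of the weights\<close>

text \<open>Multiplied by \<open>sqrt (s + 1)\<close>, the increment of the root equals
  \<open>1 / (1 + sqrt (s / (s + 1)))\<close>, which decreases in \<open>s\<close>; hence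
  \<open>s = 1\<close> is the worst case.\<close>

lemma sqrt2_diff_sqrt_le:
  fixes s :: real
  assumes "s \<ge> 1"
  shows "sqrt 2 * (sqrt (s + 1) - sqrt s) \<le> sqrt (ln 2) / sqrt (s + 1)"
proof -
  \<comment> \<open>The constants satisfy \<open>2 * 0.587\<^sup>2 < 307/443\<close>; at \<open>s = 1\<close> the sharp value is \<open>2 - \<surd>2\<close>, about 0.586.\<close>
  have ln2: "307/443 \<le> ln (2::real)"
    using ln_approx_bounds[of 2 3] by (simp add: eval_nat_numeral)
  \<comment> \<open>Squared, this is \<open>0.826 * s + 0.413\<^sup>2 \<le> s\<close>, which holds
    from about \<open>s = 0.981\<close> on. The complement \<open>1 - 0.413\<close> is the 0.587
    used next.\<close>
  have "s + 413/1000 \<le> sqrt (s * (s + 1))"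
    using assms by (intro real_le_rsqrt) (simp add: power2_eq_square algebra_simps)
  then have "(sqrt (s + 1) - sqrt s) * sqrt (s + 1) \<le> 587/1000"
    using assms by (simp add: left_diff_distrib real_sqrt_mult)
  then have "sqrt 2 * ((sqrt (s + 1) - sqrt s) * sqrt (s + 1)) \<le> sqrt 2 * (587/1000)"
    by (intro mult_left_mono) auto
  also have "\<dots> \<le> sqrt (ln 2)"
    using ln2 by (intro real_le_rsqrt) (simp add: power_mult_distrib power2_eq_square)
  finally have "sqrt 2 * (sqrt (s + 1) - sqrt s) * sqrt (s + 1) \<le> sqrt (ln 2)"
    by (simp only: mult.assoc)
  then show ?thesis using assms by (simp add: pos_le_divide_eq)
qed

text \<open>Induction on the rounds. The normaliser \<open>?c\<close> grows with each pull, so the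
  part already collected only shrinks when divided by the new one. The new weight is
  \<open>sqrt (ln 2) / (sqrt s * ?c)\<close> at the new count, and this covers the increment of
  \<open>sqrt s\<close> because all counts exceed 1.\<close>

lemma (in arm_counts) sum_w_ge:
  assumes "s0 > 1"
  shows "sqrt 2 * (sqrt (s m) - sqrt s0) / (sqrt (2 + ln (s m / s0)) * ln (2 + ln (s m / s0)))
           \<le> (\<Sum>t=1..m. w t)"
proof (induction m)
  case 0
  then show ?case by (simp add: s_def)
next
  case (Suc m)
  let ?c = "\<lambda>t. sqrt (2 + ln (s t / s0)) * ln (2 + ln (s t / s0))"
  have ln0: "0 \<le> ln (s t / s0)" for t using ratio_ge[of t] by simp
  have lln: "0 < ln (2 + ln (s t / s0))" for t using ln0[of t] by (intro ln_gt_zero) linarith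
  have c: "0 < ?c t" for t using ln0[of t] lln[of t] by (intro mult_pos_pos) auto
  show ?case
  proof (cases "b (Suc m) = 0")
    case True
    then show ?thesis using Suc.IH by (simp add: s_Suc w_def)
  next
    case False
    then have b: "b (Suc m) = 1" using b01 by blast
    have sS: "s (Suc m) = s m + 1" by (simp add: s_Suc b)
    have "ln (s m / s0) \<le> ln (s (Suc m) / s0)"
      using ratio_ge[of m] ratio_ge[of "Suc m"] s0_pos by (simp add: sS divide_right_mono)
    then have "?c m \<le> ?c (Suc m)"
      using ln0[of m] lln[of m] by (intro mult_mono) (auto simp: add_pos_nonneg)
    then have 1: "sqrt 2 * (sqrt (s m) - sqrt s0) / ?c (Suc m) \<le> sqrt 2 * (sqrt (s m) - sqrt s0) / ?c m"
      using s_ge[of m] mult_pos_pos[OF c c] by (intro divide_left_mono mult_nonneg_nonneg) auto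
    have "sqrt 2 * (sqrt (s (Suc m)) - sqrt (s m)) / ?c (Suc m)
        \<le> sqrt (ln 2) / sqrt (s (Suc m)) / ?c (Suc m)"
      unfolding sS using sqrt2_diff_sqrt_le[of "s m"] s_ge[of m] assms c[of "Suc m"] sS
      by (intro divide_right_mono) auto
    also have "\<dots> = w (Suc m)"
      using s0_pos s_ge[of "Suc m"] by (simp add: w_def b alee_f_eq[OF ratio_ge] real_sqrt_divide)
    finally have 2: "sqrt 2 * (sqrt (s (Suc m)) - sqrt (s m)) / ?c (Suc m) \<le> w (Suc m)" .
    have "sqrt 2 * (sqrt (s (Suc m)) - sqrt s0) / ?c (Suc m)
        = sqrt 2 * (sqrt (s m) - sqrt s0) / ?c (Suc m) + sqrt 2 * (sqrt (s (Suc m)) - sqrt (s m)) / ?c (Suc m)"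
      by (simp add: algebra_simps flip: add_divide_distrib diff_divide_distrib)
    also have "\<dots> \<le> (\<Sum>t=1..m. w t) + w (Suc m)" using 1 2 Suc.IH by linarith
    finally show ?thesis by simp
  qed
qed


section \<open>Concentration of predictably weighted noise\<close>

context bandit_model
begin

lemma measurable_F_mono: "f \<in> measurable (F i) N \<Longrightarrow> i \<le> j \<Longrightarrow> f \<in> measurable (F j) N"
  using sets_F_mono[of i j] by (intro measurable_from_subalg[of "F j" "F i"]) (auto simp: subalgebra_def space_F)

lemma x_measurable:
  assumes "t \<in> {1..n}" "i \<in> {1..t}"
  shows "x i \<in> borel_measurable (F (t - 1))"
proof (rule measurable_from_subalg[OF history_F[OF assms(1)]], rule measurableI)
  fix A :: "(real ^ 'k) set" assume "A \<in> sets borel"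
  then show "x i -` A \<inter> space (history M x y t) \<in> sets (history M x y t)"
    using assms(2) unfolding history_def
    by (subst sets_measure_of) (auto simp: space_measure_of_conv intro!: sigma_sets.Basic)
qed simp

lemma x_component_measurable:
  assumes "t \<in> {1..n}" "i \<in> {1..t}"
  shows "(\<lambda>\<omega>. x i \<omega> $ k) \<in> borel_measurable (F (t - 1))"
  unfolding cart_eq_inner_axis
  by (intro borel_measurable_inner x_measurable[OF assms] borel_measurable_const)

text \<open>The noise is recovered from the observation and the arm, both known at time
  \<open>t\<close>.\<close>

lemma eps_measurable:
  assumes t: "t \<in> {1..n}"
  shows "\<epsilon> t \<in> borel_measurable (F t)"
proof -
  have [measurable]: "x t \<in> borel_measurable (F t)"
    using x_measurable[OF t, of t] t by (auto intro: measurable_F_mono)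
  note y_measurable[OF t, measurable]
  have "(\<lambda>\<omega>. y t \<omega> - x t \<omega> \<bullet> \<theta>) \<in> borel_measurable (F t)" by measurable
  then show ?thesis
    using y_eq[OF t] by (subst measurable_cong[where g = "\<lambda>\<omega>. y t \<omega> - x t \<omega> \<bullet> \<theta>"]) (auto simp: space_F)
qed

text \<open>The product over rounds up to \<open>m\<close> and the multiplier of round
  \<open>Suc m\<close> are both known at time \<open>m\<close>, so conditioning on
  \<open>F m\<close> removes the last factor without increasing the integral.\<close>

lemma nn_integral_exp_supermartingale_le_1:
  assumes sub: "cond_subgaussian M F n \<epsilon> \<sigma>"
    and v: "\<And>t. t \<in> {1..n} \<Longrightarrow> v t \<in> borel_measurable (F (t - 1))"
    and "m \<le> n"
  shows "(\<integral>\<^sup>+ \<omega>. ennreal (exp (\<Sum>t=1..m. v t \<omega> * \<epsilon> t \<omega> - \<sigma>\<^sup>2 * (v t \<omega>)\<^sup>2 / 2)) \<partial>M) \<le> 1"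
  using \<open>m \<le> n\<close>
proof (induction m)
  case 0
  then show ?case by (simp add: emeasure_space_1)
next
  case (Suc m)
  let ?G = "\<lambda>\<omega>. ennreal (exp (\<Sum>t=1..m. v t \<omega> * \<epsilon> t \<omega> - \<sigma>\<^sup>2 * (v t \<omega>)\<^sup>2 / 2))"
  let ?t = "Suc m"
  interpret N: finite_measure_subalgebra M "F m"
    using F_subalgebra by unfold_locales
  have [measurable]: "v t \<in> borel_measurable (F m)" "\<epsilon> t \<in> borel_measurable (F m)" if "t \<in> {1..m}" for t
    using that Suc.prems v[of t] eps_measurable[of t] by (auto intro: measurable_F_mono)
  have "(\<integral>\<^sup>+ \<omega>. ennreal (exp (\<Sum>t=1..Suc m. v t \<omega> * \<epsilon> t \<omega> - \<sigma>\<^sup>2 * (v t \<omega>)\<^sup>2 / 2)) \<partial>M)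
      = (\<integral>\<^sup>+ \<omega>. ?G \<omega> * ennreal (exp (v ?t \<omega> * \<epsilon> ?t \<omega> - \<sigma>\<^sup>2 * (v ?t \<omega>)\<^sup>2 / 2)) \<partial>M)"
    by (simp flip: ennreal_mult' exp_add)
  also have "\<dots> \<le> (\<integral>\<^sup>+ \<omega>. ?G \<omega> \<partial>M)"
  proof (rule nn_integral_subgaussian_predictable_le[where N = "F m"])
    show "finite_measure_subalgebra M (F m)" by unfold_locales
    show "\<epsilon> ?t \<in> borel_measurable M"
      using Suc.prems by (intro measurable_from_subalg[OF F_subalgebra eps_measurable]) auto
    show "AE \<omega> in M. nn_cond_exp M (F m) (\<lambda>\<omega>. ennreal (exp (l * \<epsilon> ?t \<omega>))) \<omega>
            \<le> ennreal (exp (\<sigma>\<^sup>2 * l\<^sup>2 / 2))" for l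
      using sub Suc.prems unfolding cond_subgaussian_def by force
    show "?G \<in> borel_measurable (F m)" by measurable
    show "v ?t \<in> borel_measurable (F m)" using v[of ?t] Suc.prems by simp
  qed
  also have "\<dots> \<le> 1" using Suc by simp
  finally show ?case .
qed

lemma subgaussian_upper_tail:
  assumes sub: "cond_subgaussian M F n \<epsilon> \<sigma>" and "\<sigma> > 0" and "a \<ge> 0"
    and v: "\<And>t. t \<in> {1..n} \<Longrightarrow> v t \<in> borel_measurable (F (t - 1))"
    and V: "\<And>\<omega>. \<omega> \<in> space M \<Longrightarrow> (\<Sum>t=1..n. (v t \<omega>)\<^sup>2) \<le> 1"
  shows "prob {\<omega> \<in> space M. a \<le> (\<Sum>t=1..n. v t \<omega> * \<epsilon> t \<omega>)} \<le> exp (- (a\<^sup>2 / (2 * \<sigma>\<^sup>2)))"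
proof -
  let ?A = "{\<omega> \<in> space M. a \<le> (\<Sum>t=1..n. v t \<omega> * \<epsilon> t \<omega>)}"
  let ?E = "exp (a\<^sup>2 / (2 * \<sigma>\<^sup>2))"
  \<comment> \<open>The maximiser of \<open>l * a - \<sigma>\<^sup>2 * l\<^sup>2 / 2\<close>, whose
    maximum is the exponent in \<open>?E\<close>.\<close>
  define l where "l = a / \<sigma>\<^sup>2"
  have vM [measurable]: "v t \<in> borel_measurable M" "\<epsilon> t \<in> borel_measurable M" if "t \<in> {1..n}" for t
    using measurable_from_subalg[OF F_subalgebra v[OF that]]
      measurable_from_subalg[OF F_subalgebra eps_measurable[OF that]] by auto
  have A [measurable]: "?A \<in> sets M" by measurable
  have "ennreal ?E * emeasure M ?A = (\<integral>\<^sup>+ \<omega>. ennreal ?E * indicator ?A \<omega> \<partial>M)"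
    by (simp add: nn_integral_cmult_indicator)
  \<comment> \<open>Markov's inequality in pointwise form: on \<open>?A\<close> the exponential is
    at least \<open>?E\<close>, since \<open>l \<ge> 0\<close> and the squared weights sum to at
    most 1.\<close>
  also have "\<dots> \<le> (\<integral>\<^sup>+ \<omega>. ennreal (exp (\<Sum>t=1..n. (l * v t \<omega>) * \<epsilon> t \<omega> - \<sigma>\<^sup>2 * (l * v t \<omega>)\<^sup>2 / 2)) \<partial>M)"
  proof (rule nn_integral_mono)
    fix \<omega> assume w: "\<omega> \<in> space M"
    have "ennreal ?E \<le> ennreal (exp (\<Sum>t=1..n. (l * v t \<omega>) * \<epsilon> t \<omega> - \<sigma>\<^sup>2 * (l * v t \<omega>)\<^sup>2 / 2))"
      if "\<omega> \<in> ?A"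
    proof -
      have "a\<^sup>2 / (2 * \<sigma>\<^sup>2) = l * a - \<sigma>\<^sup>2 * l\<^sup>2 / 2 * 1"
        using \<open>\<sigma> > 0\<close> by (simp add: l_def field_simps power2_eq_square)
      also have "\<dots> \<le> l * (\<Sum>t=1..n. v t \<omega> * \<epsilon> t \<omega>) - \<sigma>\<^sup>2 * l\<^sup>2 / 2 * (\<Sum>t=1..n. (v t \<omega>)\<^sup>2)"
        using that V[OF w] \<open>a \<ge> 0\<close> by (intro diff_mono mult_left_mono) (auto simp: l_def)
      also have "\<dots> = (\<Sum>t=1..n. (l * v t \<omega>) * \<epsilon> t \<omega> - \<sigma>\<^sup>2 * (l * v t \<omega>)\<^sup>2 / 2)"
        by (simp add: sum_subtractf sum_distrib_left power_mult_distrib mult.assoc)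
      finally show ?thesis by (simp add: ennreal_leI)
    qed
    then show "ennreal ?E * indicator ?A \<omega>
        \<le> ennreal (exp (\<Sum>t=1..n. (l * v t \<omega>) * \<epsilon> t \<omega> - \<sigma>\<^sup>2 * (l * v t \<omega>)\<^sup>2 / 2))"
      by (cases "\<omega> \<in> ?A") auto
  qed
  also have "\<dots> \<le> 1"
    using v by (intro nn_integral_exp_supermartingale_le_1[OF sub]) auto
  finally have "?E * prob ?A \<le> 1"
    by (simp add: emeasure_eq_measure flip: ennreal_mult')
  then show ?thesis by (simp add: exp_minus field_simps)
qed

text \<open>A union bound over the upper tails for \<open>v\<close> and \<open>- v\<close>, which
  have the same squares.\<close>

lemma subgaussian_two_sided_tail:
  assumes sub: "cond_subgaussian M F n \<epsilon> \<sigma>" and \<sigma>: "\<sigma> > 0" and a: "a \<ge> 0"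
    and v: "\<And>t. t \<in> {1..n} \<Longrightarrow> v t \<in> borel_measurable (F (t - 1))"
    and V: "\<And>\<omega>. \<omega> \<in> space M \<Longrightarrow> (\<Sum>t=1..n. (v t \<omega>)\<^sup>2) \<le> 1"
  shows "prob {\<omega> \<in> space M. \<bar>\<Sum>t=1..n. v t \<omega> * \<epsilon> t \<omega>\<bar> \<le> a} \<ge> 1 - 2 * exp (- (a\<^sup>2 / (2 * \<sigma>\<^sup>2)))"
proof -
  have vM [measurable]: "v t \<in> borel_measurable M" "\<epsilon> t \<in> borel_measurable M" if "t \<in> {1..n}" for t
    using measurable_from_subalg[OF F_subalgebra v[OF that]]
      measurable_from_subalg[OF F_subalgebra eps_measurable[OF that]] by auto
  let ?S = "\<lambda>\<omega>. \<Sum>t=1..n. v t \<omega> * \<epsilon> t \<omega>"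
  let ?P = "{\<omega> \<in> space M. a \<le> ?S \<omega>}" and ?N = "{\<omega> \<in> space M. a \<le> - ?S \<omega>}"
  have meas: "?P \<in> events" "?N \<in> events" "{\<omega> \<in> space M. \<bar>?S \<omega>\<bar> \<le> a} \<in> events" by measurable
  have P: "prob ?P \<le> exp (- (a\<^sup>2 / (2 * \<sigma>\<^sup>2)))"
    by (rule subgaussian_upper_tail[OF sub \<sigma> a v V])
  have N: "prob ?N \<le> exp (- (a\<^sup>2 / (2 * \<sigma>\<^sup>2)))"
    using subgaussian_upper_tail[OF sub \<sigma> a, of "\<lambda>t \<omega>. - v t \<omega>"] v V by (simp add: sum_negf)
  have "1 - prob {\<omega> \<in> space M. \<bar>?S \<omega>\<bar> \<le> a} = prob (space M - {\<omega> \<in> space M. \<bar>?S \<omega>\<bar> \<le> a})"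
    using meas(3) by (simp add: prob_compl)
  also have "\<dots> \<le> prob (?P \<union> ?N)"
    using meas by (intro finite_measure_mono sets.Un) auto
  also have "\<dots> \<le> prob ?P + prob ?N" using meas by (intro measure_Un_le)
  finally show ?thesis using P N by linarith
qed

end

section \<open>The estimation error of one arm\<close>

theorem mainTheorem4:
  fixes M :: "'a measure" and F :: "nat \<Rightarrow> 'a measure"
    and n :: nat and \<theta> :: "real ^ 'k"
    and x :: "nat \<Rightarrow> 'a \<Rightarrow> real ^ 'k" and y \<epsilon> :: "nat \<Rightarrow> 'a \<Rightarrow> real"
    and s0 :: "'a \<Rightarrow> real" and \<theta>h :: "'a \<Rightarrow> real ^ 'k"
    and \<sigma> \<delta> :: real and k :: 'k
  assumes "bandit_model M F n \<theta> x y \<epsilon>"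
    and "\<sigma> > 0" and "cond_subgaussian M F n \<epsilon> \<sigma>"
    and "s0 \<in> borel_measurable (F 0)" and "\<And>\<omega>. \<omega> \<in> space M \<Longrightarrow> s0 \<omega> > 1"
    and "is_ALEE M n (alee_w s0 x) x y \<theta>h"
    and "n \<ge> 1" and "0 < \<delta>" and "\<delta> < 1"
  shows "measure M {\<omega> \<in> space M.
           ereal \<bar>\<theta>h \<omega> $ k - \<theta> $ k\<bar> \<le> alee_bound \<sigma> \<delta> (s0 \<omega>) (alee_s s0 x n k \<omega>)} \<ge> 1 - \<delta>"
proof -
  interpret bandit_model M F n \<theta> x y \<epsilon> by fact
  \<comment> \<open>The model describes \<open>x\<close> only in rounds 1 to \<open>n\<close>,
    whereas \<open>arm_counts\<close> asks for values 0 or 1 in every round; hence the extension by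
    0.\<close>
  define b where "b \<omega> t = (if t \<in> {1..n} then x t \<omega> $ k else 0)" for \<omega> t
  define v where "v t \<omega> = alee_w s0 x t \<omega> $ k" for t \<omega>
  define sn where "sn = alee_s s0 x n k"
  define S where "S \<omega> = (\<Sum>t=1..n. v t \<omega> * \<epsilon> t \<omega>)" for \<omega>
  define W where "W \<omega> = (\<Sum>t=1..n. v t \<omega>)" for \<omega>
  define c where "c \<omega> = sqrt (2 + ln (sn \<omega> / s0 \<omega>)) * ln (2 + ln (sn \<omega> / s0 \<omega>))" for \<omega>
  define B where "B \<omega> = \<sigma> * sqrt (ln (2 / \<delta>\<^sup>2)) * (c \<omega> / (sqrt (sn \<omega>) - sqrt (s0 \<omega>)))" for \<omega>
  \<comment> \<open>Chosen so that \<open>2 * exp (- (a\<^sup>2 / (2 * \<sigma>\<^sup>2)))\<close>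
    equals \<open>\<delta>\<^sup>2\<close>.\<close>
  define a where "a = \<sigma> * sqrt (2 * ln (2 / \<delta>\<^sup>2))"
  let ?G = "{\<omega> \<in> space M. ereal \<bar>\<theta>h \<omega> $ k - \<theta> $ k\<bar> \<le> alee_bound \<sigma> \<delta> (s0 \<omega>) (alee_s s0 x n k \<omega>)}"
  have arm: "arm_counts (b \<omega>) (s0 \<omega>)" if w: "\<omega> \<in> space M" for \<omega>
  proof
    show "b \<omega> t = 0 \<or> b \<omega> t = 1" for t
      using x_basis[OF _ w, of t] by (auto simp: b_def axis_def)
    show "s0 \<omega> > 0" using assms(5)[OF w] by simp
  qed
  have s_eq: "arm_counts.s (b \<omega>) (s0 \<omega>) t = alee_s s0 x t k \<omega>" if "\<omega> \<in> space M" "t \<le> n" for \<omega> t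
    unfolding arm_counts.s_def[OF arm[OF that(1)]] alee_s_def
    using that by (auto simp: b_def intro!: sum.cong)
  have w_eq: "arm_counts.w (b \<omega>) (s0 \<omega>) t = v t \<omega>" if "\<omega> \<in> space M" "t \<in> {1..n}" for \<omega> t
    unfolding arm_counts.w_def[OF arm[OF that(1)]] v_def alee_w_def
    using that s_eq[OF that(1), of t] by (simp add: b_def)
  have sn_eq: "arm_counts.s (b \<omega>) (s0 \<omega>) n = sn \<omega>" if "\<omega> \<in> space M" for \<omega>
    using s_eq[OF that, of n] by (simp add: sn_def)
  have sn_ge: "sn \<omega> \<ge> s0 \<omega>" if "\<omega> \<in> space M" for \<omega>
    using arm_counts.s_ge[OF arm[OF that], of n] sn_eq[OF that] by simp
  have ln_ratio: "0 \<le> ln (sn \<omega> / s0 \<omega>)" if "\<omega> \<in> space M" for \<omega>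
    using sn_ge[OF that] assms(5)[OF that] by (intro ln_ge_zero) simp
  have ln_pos: "ln (2 + ln (sn \<omega> / s0 \<omega>)) > 0" if "\<omega> \<in> space M" for \<omega>
    using ln_ratio[OF that] by (intro ln_gt_zero) linarith
  have c_pos: "c \<omega> > 0" if "\<omega> \<in> space M" for \<omega>
    using ln_ratio[OF that] ln_pos[OF that] by (simp add: c_def)
  have V: "(\<Sum>t=1..n. (v t \<omega>)\<^sup>2) \<le> 1" if "\<omega> \<in> space M" for \<omega>
  proof -
    have "(\<Sum>t=1..n. (v t \<omega>)\<^sup>2) = (\<Sum>t=1..n. (arm_counts.w (b \<omega>) (s0 \<omega>) t)\<^sup>2)"
      using w_eq[OF that] by (intro sum.cong) auto
    also have "\<dots> \<le> 1 - ln 2 / ln (2 + ln (sn \<omega> / s0 \<omega>))"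
      using arm_counts.sum_w_squared_le[OF arm[OF that], of n] sn_eq[OF that] by simp
    also have "\<dots> \<le> 1" using ln_pos[OF that] by simp
    finally show ?thesis .
  qed
  have W_ge: "sqrt 2 * (sqrt (sn \<omega>) - sqrt (s0 \<omega>)) / c \<omega> \<le> W \<omega>" if "\<omega> \<in> space M" for \<omega>
  proof -
    have "W \<omega> = (\<Sum>t=1..n. arm_counts.w (b \<omega>) (s0 \<omega>) t)"
      unfolding W_def using w_eq[OF that] by (intro sum.cong) auto
    then show ?thesis
      using arm_counts.sum_w_ge[OF arm[OF that] assms(5)[OF that], of n] sn_eq[OF that]
      by (simp add: c_def)
  qed
  \<comment> \<open>Stated as a product, the identity also covers outcomes where the arm is never
    pulled and \<open>W\<close> vanishes.\<close>
  have err: "(\<theta>h \<omega> $ k - \<theta> $ k) * W \<omega> = S \<omega>" if w: "\<omega> \<in> space M" for \<omega>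
  proof -
    have "0 = (\<Sum>t=1..n. (y t \<omega> - x t \<omega> \<bullet> \<theta>h \<omega>) *\<^sub>R alee_w s0 x t \<omega>) $ k"
      using assms(6) w by (simp add: is_ALEE_def)
    also have "\<dots> = (\<Sum>t=1..n. (y t \<omega> - x t \<omega> \<bullet> \<theta>h \<omega>) * v t \<omega>)"
      by (simp add: v_def)
    also have "\<dots> = (\<Sum>t=1..n. v t \<omega> * \<epsilon> t \<omega> - (\<theta>h \<omega> $ k - \<theta> $ k) * v t \<omega>)"
    proof (intro sum.cong refl)
      fix t assume t: "t \<in> {1..n}"
      obtain j where j: "x t \<omega> = axis j 1" using x_basis[OF t w] by blast
      show "(y t \<omega> - x t \<omega> \<bullet> \<theta>h \<omega>) * v t \<omega> = v t \<omega> * \<epsilon> t \<omega> - (\<theta>h \<omega> $ k - \<theta> $ k) * v t \<omega>"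
      \<comment> \<open>In a round that pulls arm \<open>k\<close> the inner products reduce to the
        \<open>k\<close>-th coordinates; in any other round the weight is 0.\<close>
      proof (cases "j = k")
        case True
        then show ?thesis using y_eq[OF t w] by (simp add: j inner_axis' algebra_simps)
      next
        case False
        then have "v t \<omega> = 0" by (simp add: v_def alee_w_def j axis_def)
        then show ?thesis by simp
      qed
    qed
    also have "\<dots> = S \<omega> - (\<theta>h \<omega> $ k - \<theta> $ k) * W \<omega>"
      by (simp add: S_def W_def sum_subtractf sum_distrib_left)
    finally show ?thesis by simp
  qed
  \<comment> \<open>The weight of round \<open>t\<close> depends on \<open>x t\<close>, also through
    the updated count, but the arm of round \<open>t\<close> is already known at time
    \<open>t - 1\<close>.\<close>
  have v_meas: "v t \<in> borel_measurable (F (t - 1))" if t: "t \<in> {1..n}" for t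
  proof -
    define N where "N = F (t - 1)"
    have xk [measurable]: "(\<lambda>\<omega>. x i \<omega> $ k) \<in> borel_measurable N" if "i \<in> {1..t}" for i
      unfolding N_def by (rule x_component_measurable[OF t that])
    have [measurable]: "(\<lambda>\<omega>. x t \<omega> $ k) \<in> borel_measurable N" using xk[of t] t by simp
    have [measurable]: "s0 \<in> borel_measurable N" unfolding N_def by (rule measurable_F_mono[OF assms(4)]) simp
    show ?thesis unfolding N_def[symmetric] v_def alee_w_def vec_lambda_beta alee_s_def alee_f_def by measurable
  qed
  have [measurable]: "v t \<in> borel_measurable M" "\<epsilon> t \<in> borel_measurable M"
    "(\<lambda>\<omega>. x t \<omega> $ k) \<in> borel_measurable M"
    if "t \<in> {1..n}" for t
    using that measurable_from_subalg[OF F_subalgebra v_meas[OF that]]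
      measurable_from_subalg[OF F_subalgebra eps_measurable[OF that]]
      measurable_from_subalg[OF F_subalgebra x_component_measurable[OF that, of t]] by auto
  have [measurable]: "s0 \<in> borel_measurable M"
    by (rule measurable_from_subalg[OF F_subalgebra assms(4)])
  have [measurable]: "sn \<in> borel_measurable M" unfolding sn_def alee_s_def by measurable
  have [measurable]: "S \<in> borel_measurable M" "W \<in> borel_measurable M" "c \<in> borel_measurable M"
    "B \<in> borel_measurable M"
    unfolding S_def W_def c_def B_def by measurable
  have bound: "alee_bound \<sigma> \<delta> (s0 \<omega>) (alee_s s0 x n k \<omega>) = (if sn \<omega> = s0 \<omega> then \<infinity> else ereal (B \<omega>))" for \<omega>
    by (simp add: alee_bound_def B_def c_def sn_def)
  have W_pos: "W \<omega> > 0" if "\<omega> \<in> space M" "sn \<omega> \<noteq> s0 \<omega>" for \<omega>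
  proof -
    have "0 < sqrt 2 * (sqrt (sn \<omega>) - sqrt (s0 \<omega>)) / c \<omega>"
      using that sn_ge[OF that(1)] c_pos[OF that(1)] by (intro divide_pos_pos mult_pos_pos) auto
    then show ?thesis using W_ge[OF that(1)] by linarith
  qed
  have err_eq: "\<theta>h \<omega> $ k - \<theta> $ k = S \<omega> / W \<omega>" if "\<omega> \<in> space M" "sn \<omega> \<noteq> s0 \<omega>" for \<omega>
    using err[OF that(1)] W_pos[OF that] by (simp add: field_simps)
  \<comment> \<open>\<open>\<theta>h\<close> itself need not be measurable, but it is determined wherever arm \<open>k\<close> has been pulled.\<close>
  have G_eq: "?G = {\<omega> \<in> space M. sn \<omega> = s0 \<omega> \<or> \<bar>S \<omega> / W \<omega>\<bar> \<le> B \<omega>}"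
    by (intro Collect_cong conj_cong refl) (simp add: bound err_eq)
  have G_meas: "?G \<in> events" unfolding G_eq by measurable
  have ln_nonneg: "ln (2 / \<delta>\<^sup>2) \<ge> 0"
  proof -
    have "\<delta>\<^sup>2 \<le> 1" using assms(8,9) by (simp add: power_le_one)
    then show ?thesis using assms(8) by (intro ln_ge_zero) (simp add: field_simps)
  qed
  have sub: "{\<omega> \<in> space M. \<bar>S \<omega>\<bar> \<le> a} \<subseteq> ?G"
  proof -
    have "\<bar>S \<omega> / W \<omega>\<bar> \<le> B \<omega>" if w: "\<omega> \<in> space M" and ne: "sn \<omega> \<noteq> s0 \<omega>" and S: "\<bar>S \<omega>\<bar> \<le> a" for \<omega>
    proof -
      have d: "sqrt (sn \<omega>) - sqrt (s0 \<omega>) > 0" using ne sn_ge[OF w] by simp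
      have B_nonneg: "B \<omega> \<ge> 0"
        using d c_pos[OF w] assms(2) ln_nonneg by (simp add: B_def)
      \<comment> \<open>The right-hand side equals \<open>a\<close>: \<open>c\<close> and the
        difference of roots cancel, and the \<open>sqrt 2\<close> from the lower bound on
        \<open>W\<close> supplies the 2 under the root in \<open>a\<close>.\<close>
      have "\<bar>S \<omega>\<bar> \<le> B \<omega> * (sqrt 2 * (sqrt (sn \<omega>) - sqrt (s0 \<omega>)) / c \<omega>)"
        using S d c_pos[OF w] by (simp add: B_def a_def real_sqrt_mult mult_ac)
      also have "\<dots> \<le> B \<omega> * W \<omega>" using W_ge[OF w] B_nonneg by (intro mult_left_mono)
      finally show ?thesis using W_pos[OF w ne] by (simp add: abs_divide pos_divide_le_eq)
    qed
    then show ?thesis unfolding G_eq by blast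
  qed
  \<comment> \<open>The two-sided tail gives the stronger level \<open>1 - \<delta>\<^sup>2\<close>;
    the stated one follows from \<open>\<delta> < 1\<close>.\<close>
  have "1 - \<delta> \<le> 1 - \<delta>\<^sup>2"
    using assms(8,9) by (simp add: power2_eq_square mult_left_le)
  also have "\<dots> = 1 - 2 * exp (- (a\<^sup>2 / (2 * \<sigma>\<^sup>2)))"
    using assms(2,8) ln_nonneg by (simp add: a_def power_mult_distrib exp_minus)
  also have "\<dots> \<le> prob {\<omega> \<in> space M. \<bar>S \<omega>\<bar> \<le> a}"
    unfolding S_def using assms(2) ln_nonneg
    by (intro subgaussian_two_sided_tail[OF assms(3)] v_meas V) (auto simp: a_def)
  also have "\<dots> \<le> prob ?G" by (intro finite_measure_mono sub G_meas)
  finally show ?thesis .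
qed

end
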